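(* Let $\mathbb{F}$ be a field and let $L=H_3(\mathbb{F})\oplus\mathbb{F}e_4$ be the four-dimensional Lie algebra with basis $e_1,e_2,e_3,e_4$ whose only nonzero bracket of basis vectors (up to antisymmetry) is $[e_1,e_2]=e_3$. Put $Z=\mathbb{F}e_3+\mathbb{F}e_4$, and let $\mathcal{L}$, $\mathcal{P}_2$, $\mathcal{P}_3$ be the sets of one-, two- and three-dimensional subalgebras of $L$. Then: (1) The three-dimensional subalgebras of $L$ are exactly those of the following two types: $\mathcal{P}_{3,1}(\lambda,\mu)=\mathbb{F}(e_1+\lambda e_4)+\mathbb{F}(e_2+\mu e_4)+\mathbb{F}e_3$ with $\lambda,\mu\in\mathbb{F}$ (these are Heisenberg algebras), and $\mathcal{P}_{3,2}(\lambda,\mu)=Z+\mathbb{F}(\lambda e_1+\mu e_2)$ with $(\lambda,\mu)\neq(0,0)$ (these are abelian). If $\mathbb{F}=\mathbb{F}_q$ there are $q^2$ of the former and $q+1$ of the latter, making $q^2+q+1$ in total. (2) $L$ has no two-dimensional maximal subalgebras. Every two-dimensional subalgebra contained in some $\mathcal{P}_{3,1}(\lambda,\mu)$ contains $e_3$ and is therefore of the form $\mathbb{F}e_3+\mathbb{F}(\alpha e_1+\beta e_2+\gamma e_4)$ with $(\alpha,\beta,\gamma)\ne(0,0,0)$; if $\mathbb{F}=\mathbb{F}_q$ there are $q^2+q+1$ subalgebras of this form, and (over any $\mathbb{F}$) each of them is also contained in some $\mathcal{P}_{3,2}(\lambda',\mu')$. As $\mathcal{P}_{3,2}(\lambda,\mu)$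 is abelian, every two-dimensional subspace of it is a subalgebra; if $\mathbb{F}=\mathbb{F}_q$, there are $q^3+2q^2+q+1$ two-dimensional subalgebras contained in subalgebras of the type $\mathcal{P}_{3,2}(\lambda,\mu)$. (3) If $A,B\in\mathcal{P}_3$ with $A\neq B$, then $A\sim B$ in $\Gamma(L)$. If $\mathbb{F}=\mathbb{F}_q$, the induced subgraph of $\Gamma(L)$ on $\mathcal{P}_3$ is the complete graph $K_{q^2+q+1}$. (4) If $A,B\in\mathcal{P}_2$, then $A\sim B$ if and only if $A$ and $B$ are not both contained in the same member of $\mathcal{P}_3$. (5) If $A\in\mathcal{L}$ and $B\in\mathcal{P}_2$, then $A\sim B$ if and only if $A$ and $B$ are not both contained in the same member of $\mathcal{P}_3$.
   Context: For a finite-dimensional Lie algebra $L$, the comaximal graph $\Gamma(L)$ is the simple undirected graph whose vertices are the proper nonzero Lie subalgebras of $L$; two distinct vertices $A,B$ are adjacent (written $A\sim B$) if and only if the Lie subalgebra $\langle A,B\rangle$ generated by $A\cup B$ equals $L$. A Heisenberg algebra here is a Lie algebra isomorphic to the three-dimensional one $H_3(\mathbb{F})$ with basis $a,b,c$ and $[a,b]=c$, $[a,c]=[b,c]=0$. *)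

theory Defs
  imports "HOL-Analysis.Cartesian_Space" "Graph_Theory.Graph_Theory"
begin

locale lie_algebra = vector_space scale
  for scale :: "'a::field \<Rightarrow> 'b::ab_group_add \<Rightarrow> 'b" +
  fixes bracket :: "'b \<Rightarrow> 'b \<Rightarrow> 'b"
  assumes bracket_linear_right: "Vector_Spaces.linear scale scale (\<lambda>y. bracket x y)"
    and bracket_linear_left: "Vector_Spaces.linear scale scale (\<lambda>x. bracket x y)"
    and bracket_self: "bracket x x = 0"
    and jacobi: "bracket x (bracket y z) + bracket y (bracket z x) + bracket z (bracket x y) = 0"

text \<open>Isomorphism between a subalgebra \<open>S\<close> of one Lie algebra and a subalgebra \<open>T\<close> of another;
  the map is only constrained on \<open>S\<close>.\<close>

definition lie_isomorphic ::
  "('a::field \<Rightarrow> 'b::ab_group_add \<Rightarrow> 'b) \<Rightarrow> ('b \<Rightarrow> 'b \<Rightarrow> 'b) \<Rightarrow> 'b set \<Rightarrow>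
   ('a \<Rightarrow> 'c::ab_group_add \<Rightarrow> 'c) \<Rightarrow> ('c \<Rightarrow> 'c \<Rightarrow> 'c) \<Rightarrow> 'c set \<Rightarrow> bool" where
  "lie_isomorphic scale1 bracket1 S scale2 bracket2 T \<longleftrightarrow>
     (\<exists>f. bij_betw f S T \<and>
        (\<forall>x\<in>S. \<forall>y\<in>S. f (x + y) = f x + f y) \<and>
        (\<forall>c. \<forall>x\<in>S. f (scale1 c x) = scale2 c (f x)) \<and>
        (\<forall>x\<in>S. \<forall>y\<in>S. f (bracket1 x y) = bracket2 (f x) (f y)))"

text \<open>The Lie algebra \<open>H\<^sub>3\<close> on \<open>'a ^ 3\<close>: the standard basis \<open>a, b, c\<close> satisfies \<open>[a,b] = c\<close> and
  \<open>[a,c] = [b,c] = 0\<close>.\<close>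

definition h3_bracket :: "'a::field ^ 3 \<Rightarrow> 'a ^ 3 \<Rightarrow> 'a ^ 3" where
  "h3_bracket x y = (x $ 1 * y $ 2 - x $ 2 * y $ 1) *s axis 3 1"

context lie_algebra
begin

definition subalgebra :: "'b set \<Rightarrow> bool" where
  "subalgebra S \<longleftrightarrow> subspace S \<and> (\<forall>x\<in>S. \<forall>y\<in>S. bracket x y \<in> S)"

definition subalgebras_of_dim :: "nat \<Rightarrow> 'b set set" where
  "subalgebras_of_dim n = {S. subalgebra S \<and> dim S = n}"

definition generated :: "'b set \<Rightarrow> 'b set" where
  "generated X = subalgebra hull X"

definition maximal_subalgebra :: "'b set \<Rightarrow> bool" where
  "maximal_subalgebra M \<longleftrightarrow> subalgebra M \<and> M \<noteq> UNIV \<and>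
     (\<forall>S. subalgebra S \<longrightarrow> M \<subseteq> S \<longrightarrow> S = M \<or> S = UNIV)"

definition abelian :: "'b set \<Rightarrow> bool" where
  "abelian S \<longleftrightarrow> (\<forall>x\<in>S. \<forall>y\<in>S. bracket x y = 0)"

definition heisenberg :: "'b set \<Rightarrow> bool" where
  "heisenberg S \<longleftrightarrow> subalgebra S \<and>
     lie_isomorphic scale bracket S (*s) h3_bracket (UNIV :: ('a ^ 3) set)"

text \<open>As usual in the graph library, a simple undirected graph is represented by the symmetric
  loop-free digraph having both orientations of each edge as arcs.\<close>

definition comaximal_graph :: "('b set, 'b set \<times> 'b set) pre_digraph" where
  "comaximal_graph =
     (let V = {S. subalgebra S \<and> S \<noteq> {0} \<and> S \<noteq> UNIV}
      in with_proj \<lparr>pverts = V,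
           parcs = {(A, B). A \<in> V \<and> B \<in> V \<and> A \<noteq> B \<and> generated (A \<union> B) = UNIV}\<rparr>)"

lemma comaximal_graph_adj:
  "A \<rightarrow>\<^bsub>comaximal_graph\<^esub> B \<longleftrightarrow>
     A \<in> verts comaximal_graph \<and> B \<in> verts comaximal_graph \<and> A \<noteq> B \<and> generated (A \<union> B) = UNIV"
  by (auto simp: comaximal_graph_def Let_def)

lemma comaximal_graph_sym:
  "A \<rightarrow>\<^bsub>comaximal_graph\<^esub> B \<longleftrightarrow> B \<rightarrow>\<^bsub>comaximal_graph\<^esub> A"
  by (auto simp: comaximal_graph_adj Un_commute)

end

text \<open>The Lie algebra \<open>L\<close> (the direct sum of \<open>H\<^sub>3\<close> and a line) on \<open>'a ^ 4\<close>; \<open>e i\<close> is its \<open>i\<close>-th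
  standard basis vector.\<close>

abbreviation e :: "4 \<Rightarrow> 'a::field ^ 4" where
  "e i \<equiv> axis i 1"

definition L_bracket :: "'a::field ^ 4 \<Rightarrow> 'a ^ 4 \<Rightarrow> 'a ^ 4" where
  "L_bracket x y = (x $ 1 * y $ 2 - x $ 2 * y $ 1) *s e 3"

global_interpretation H3: lie_algebra "(*s)" "h3_bracket :: 'a::field ^ 3 \<Rightarrow> 'a ^ 3 \<Rightarrow> 'a ^ 3"
  by unfold_locales
    (auto simp: h3_bracket_def vec_eq_iff axis_def algebra_simps)

global_interpretation L: lie_algebra "(*s)" "L_bracket :: 'a::field ^ 4 \<Rightarrow> 'a ^ 4 \<Rightarrow> 'a ^ 4"
  by unfold_locales
    (auto simp: L_bracket_def vec_eq_iff axis_def algebra_simps)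

lemma h3_bracket_basis:
  fixes a b c :: "'a::field ^ 3"
  defines "a \<equiv> axis 1 1" and "b \<equiv> axis 2 1" and "c \<equiv> axis 3 1"
  shows "h3_bracket a b = c" "h3_bracket a c = 0" "h3_bracket b c = 0"
  by (simp_all add: a_def b_def c_def h3_bracket_def axis_def)

lemma L_bracket_basis:
  "L_bracket (e i) (e j) = (if i = 1 \<and> j = 2 then e 3 else if i = 2 \<and> j = 1 then - e 3 else 0)"
  by (auto simp: L_bracket_def axis_def vec_eq_iff)

definition Z :: "('a::field ^ 4) set" where
  "Z = vec.span {e 3, e 4}"

definition P31 :: "'a::field \<Rightarrow> 'a \<Rightarrow> ('a ^ 4) set" where
  "P31 l m = vec.span {e 1 + l *s e 4, e 2 + m *s e 4, e 3}"

definition P32 :: "'a::field \<Rightarrow> 'a \<Rightarrow> ('a ^ 4) set" where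
  "P32 l m = vec.span (Z \<union> {l *s e 1 + m *s e 2})"

definition Pe3 :: "'a::field \<Rightarrow> 'a \<Rightarrow> 'a \<Rightarrow> ('a ^ 4) set" where
  "Pe3 a b c = vec.span {e 3, a *s e 1 + b *s e 2 + c *s e 4}"

end

theory Submission
  imports Defs
begin

text \<open>A subspace is abelian exactly when its projection to the coordinates \<open>1, 2\<close> is at most
  one-dimensional, that is, when it lies in some \<open>P32 l m\<close>. A non-abelian subalgebra contains
  \<open>e 3\<close> as a commutator and hence contains some \<open>P31 l m\<close>. By this dichotomy every proper subalgebra
  lies in a three-dimensional one, so two subalgebras generate \<open>L\<close> if and only if no
  three-dimensional subalgebra contains both; this gives all adjacency claims at once. The two-dimensional subalgebras
  other than \<open>Z\<close> are counted by the pair of their projection to the coordinates \<open>1, 2\<close>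
  and their intersection with \<open>Z\<close> (two points of a projective line), together with an affine
  parameter.\<close>

section \<open>Coordinate descriptions of the subspaces\<close>

lemma vec4_eq_iff: "x = y \<longleftrightarrow> x $ 1 = y $ 1 \<and> x $ 2 = y $ 2 \<and> x $ 3 = y $ 3 \<and> x $ 4 = y $ 4"
  for x y :: "'a ^ 4"
  by (simp add: vec_eq_iff forall_4)

lemma axis4_nth [simp]:
  "e 1 $ 1 = 1" "e 1 $ 2 = 0" "e 1 $ 3 = 0" "e 1 $ 4 = 0"
  "e 2 $ 1 = 0" "e 2 $ 2 = 1" "e 2 $ 3 = 0" "e 2 $ 4 = 0"
  "e 3 $ 1 = 0" "e 3 $ 2 = 0" "e 3 $ 3 = 1" "e 3 $ 4 = 0"
  "e 4 $ 1 = 0" "e 4 $ 2 = 0" "e 4 $ 3 = 0" "e 4 $ 4 = 1"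
  by (simp_all add: axis_def)

text \<open>Peeling off one generator at a time turns membership in a concrete span into a system of
  coordinate equations.\<close>

lemma mem_span_insert: "x \<in> vec.span (insert a S) \<longleftrightarrow> (\<exists>k. x - k *s a \<in> vec.span S)"
  by (simp add: vec.span_insert)

text \<open>The three generators span a hyperplane, which is the kernel of a single linear
  functional. Later arguments use this equation instead of the span.\<close>

lemma mem_P31: "x \<in> P31 l m \<longleftrightarrow> x $ 4 = l * x $ 1 + m * x $ 2"
proof
  assume "x $ 4 = l * x $ 1 + m * x $ 2"
  then have "x - x $ 1 *s (e 1 + l *s e 4) - x $ 2 *s (e 2 + m *s e 4) - x $ 3 *s e 3 = 0"
    by (simp add: vec4_eq_iff algebra_simps)
  then show "x \<in> P31 l m"
    unfolding P31_def mem_span_insert vec.span_empty by blast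
next
  assume "x \<in> P31 l m"
  then show "x $ 4 = l * x $ 1 + m * x $ 2"
    by (auto simp: P31_def mem_span_insert vec4_eq_iff algebra_simps)
qed

lemma mem_Z: "x \<in> Z \<longleftrightarrow> x $ 1 = 0 \<and> x $ 2 = 0"
proof
  assume "x $ 1 = 0 \<and> x $ 2 = 0"
  then have "x - x $ 3 *s e 3 - x $ 4 *s e 4 = 0"
    by (simp add: vec4_eq_iff)
  then show "x \<in> Z"
    unfolding Z_def mem_span_insert vec.span_empty by blast
qed (auto simp: Z_def mem_span_insert vec4_eq_iff)

lemma span_Z: "vec.span Z = Z"
  by (simp add: Z_def)

lemma dim_Z: "vec.dim Z = 2"
  by (simp add: Z_def vec.dim_insert mem_span_insert vec4_eq_iff)

text \<open>Adding \<open>Z\<close> makes the coordinates 3 and 4 free, so only the projection to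
  the coordinates 1 and 2 matters. For \<open>l = m = 0\<close> this describes \<open>Z\<close>
  itself.\<close>

lemma mem_P32_span: "x \<in> P32 l m \<longleftrightarrow> (\<exists>k. x $ 1 = k * l \<and> x $ 2 = k * m)"
proof -
  have "x \<in> P32 l m \<longleftrightarrow> (\<exists>k. x - k *s (l *s e 1 + m *s e 2) \<in> Z)"
    unfolding P32_def Un_insert_right Un_empty_right mem_span_insert span_Z ..
  then show ?thesis
    by (simp add: mem_Z)
qed

text \<open>Proportionality to a nonzero pair is the vanishing of a 2 by 2 determinant. It is
  applied to the first two coordinates and, within \<open>Z\<close>, to the last two.\<close>

lemma proportional_iff:
  fixes l m x y :: "'a::field"
  assumes "(l, m) \<noteq> (0, 0)"
  shows "(\<exists>k. x = k * l \<and> y = k * m) \<longleftrightarrow> m * x = l * y"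
proof
  assume *: "m * x = l * y"
  show "\<exists>k. x = k * l \<and> y = k * m"
  proof (cases "l = 0")
    case True
    with * assms show ?thesis
      by (auto intro!: exI[of _ "y / m"])
  next
    case False
    with * show ?thesis
      by (auto simp: field_simps intro!: exI[of _ "x / l"])
  qed
qed auto

lemma mem_P32: "(l, m) \<noteq> (0, 0) \<Longrightarrow> x \<in> P32 l m \<longleftrightarrow> m * x $ 1 = l * x $ 2"
  unfolding mem_P32_span by (rule proportional_iff)

lemma mem_Pe3: "x \<in> Pe3 a b c \<longleftrightarrow> (\<exists>k. x $ 1 = k * a \<and> x $ 2 = k * b \<and> x $ 4 = k * c)"
proof -
  \<comment> \<open>The coefficient of \<open>e 3\<close> only has to match coordinate 3, so a
    suitable one always exists.\<close>
  have "(\<exists>k. x $ 3 = k) \<longleftrightarrow> True" by simp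
  then show ?thesis
    by (auto simp: Pe3_def mem_span_insert vec4_eq_iff)
qed

lemma dim_P31: "vec.dim (P31 l m) = 3"
  by (simp add: P31_def vec.dim_insert mem_span_insert vec4_eq_iff)

lemma dim_P32: "(l, m) \<noteq> (0, 0) \<Longrightarrow> vec.dim (P32 l m) = 3"
  by (simp add: P32_def vec.dim_insert span_Z mem_Z dim_Z)

lemma dim_Pe3: "(a, b, c) \<noteq> (0, 0, 0) \<Longrightarrow> vec.dim (Pe3 a b c) = 2"
  by (auto simp: Pe3_def vec.dim_insert mem_span_insert vec4_eq_iff)

lemma subspace_P [simp]: "vec.subspace (P31 l m)" "vec.subspace (P32 l m)" "vec.subspace (Pe3 a b c)" "vec.subspace Z"
  by (simp_all add: P31_def P32_def Pe3_def Z_def)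

lemma e3_in_P [simp]: "e 3 \<in> P31 l m" "e 3 \<in> P32 l m" "e 3 \<in> Pe3 a b c"
  by (auto simp: mem_P31 mem_P32_span mem_Pe3 intro: exI[of _ 0])

section \<open>Abelian and non-abelian subalgebras\<close>

text \<open>Every bracket is a multiple of \<open>e 3\<close>.\<close>

lemma subalgebra_if_e3:
  assumes "vec.subspace S" "e 3 \<in> S"
  shows "L.subalgebra S"
  using assms by (simp add: L.subalgebra_def L_bracket_def vec.subspace_scale)

text \<open>An element \<open>u\<close> of \<open>S\<close> outside \<open>Z\<close> fixes the
  direction: whatever commutes with \<open>u\<close> has its first two coordinates proportional to
  those of \<open>u\<close>. Inside \<open>Z\<close> any direction will do.\<close>

lemma subspace_abelian_subset_P32:
  assumes S: "vec.subspace S" and ab: "L.abelian S"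
  obtains l m where "(l, m) \<noteq> (0, 0)" "S \<subseteq> P32 l m"
proof (cases "S \<subseteq> Z")
  case True
  then have "S \<subseteq> P32 1 0"
    by (auto simp: mem_Z mem_P32_span)
  then show ?thesis
    using that[of 1 0] by simp
next
  case False
  then obtain u where "u \<in> S" "u \<notin> Z"
    by blast
  then have u: "u \<in> S" "(u $ 1, u $ 2) \<noteq> (0, 0)"
    by (simp_all add: mem_Z)
  have "x \<in> P32 (u $ 1) (u $ 2)" if "x \<in> S" for x
  proof -
    \<comment> \<open>This coordinate of the bracket is the determinant of the first two coordinates
      of \<open>u\<close> and \<open>x\<close>.\<close>
    have "L_bracket u x $ 3 = 0"
      using ab u that by (simp add: L.abelian_def)
    then show ?thesis
      using u by (simp add: mem_P32 L_bracket_def)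
  qed
  with u that show ?thesis by blast
qed

text \<open>Two non-commuting elements have linearly independent projections to the coordinates 1
  and 2, and their commutator is a nonzero multiple of \<open>e 3\<close>; together these give all
  three generators.\<close>

lemma subalgebra_nonabelian_superset_P31:
  assumes S: "L.subalgebra S" and ab: "\<not> L.abelian S"
  obtains l m where "P31 l m \<subseteq> S"
proof -
  have sub: "vec.subspace S"
    using S by (simp add: L.subalgebra_def)
  obtain x y where xy: "x \<in> S" "y \<in> S" "L_bracket x y \<noteq> 0"
    using ab by (auto simp: L.abelian_def)
  define d where "d = x $ 1 * y $ 2 - x $ 2 * y $ 1"
  have d: "d \<noteq> 0"
    using xy by (auto simp: L_bracket_def d_def)
  have "d *s e 3 \<in> S"
    using S xy by (auto simp: L.subalgebra_def L_bracket_def d_def)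
  then have "inverse d *s (d *s e 3) \<in> S"
    using sub vec.subspace_scale by blast
  then have e3: "e 3 \<in> S"
    using d by simp
  \<comment> \<open>Cramer's rule: \<open>u\<close> and \<open>v\<close> are the combinations of
    \<open>x\<close> and \<open>y\<close> that project to (1, 0) and (0, 1) in the first two
    coordinates.\<close>
  define u where "u = inverse d *s (y $ 2 *s x - x $ 2 *s y)"
  define v where "v = inverse d *s (x $ 1 *s y - y $ 1 *s x)"
  have uv: "u \<in> S" "v \<in> S"
    unfolding u_def v_def
    by (intro vec.subspace_scale vec.subspace_diff sub xy)+
  have uv_nth: "u $ 1 = 1" "u $ 2 = 0" "v $ 1 = 0" "v $ 2 = 1"
  proof -
    have "u $ 1 = inverse d * d" "v $ 2 = inverse d * d"
      by (simp_all add: u_def v_def d_def algebra_simps)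
    then show "u $ 1 = 1" "v $ 2 = 1"
      using d by simp_all
    show "u $ 2 = 0" "v $ 1 = 0"
      by (simp_all add: u_def v_def)
  qed
  \<comment> \<open>Since \<open>e 3\<close> lies in \<open>S\<close>, coordinate 3 can be cleared;
    coordinate 4 then supplies the parameters.\<close>
  have "e 1 + u $ 4 *s e 4 = u - u $ 3 *s e 3" "e 2 + v $ 4 *s e 4 = v - v $ 3 *s e 3"
    using uv_nth by (simp_all add: vec4_eq_iff)
  then have "e 1 + u $ 4 *s e 4 \<in> S" "e 2 + v $ 4 *s e 4 \<in> S"
    using uv e3 sub by (simp_all add: vec.subspace_diff vec.subspace_scale)
  then have "P31 (u $ 4) (v $ 4) \<subseteq> S"
    unfolding P31_def using e3 sub by (intro vec.span_minimal) auto
  then show ?thesis by (rule that)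
qed

section \<open>The three-dimensional subalgebras\<close>

text \<open>In either case of the dichotomy there is an inclusion between \<open>S\<close> and a
  hyperplane of the list, and equal dimensions turn it into an equality.\<close>

lemma subalgebras_dim3:
  "L.subalgebras_of_dim 3 = {P31 l m | l m. True} \<union> {P32 l m | l m. (l, m) \<noteq> (0, 0)}"
  (is "_ = ?A \<union> ?B")
proof (intro equalityI subsetI)
  fix S :: "('a ^ 4) set" assume "S \<in> L.subalgebras_of_dim 3"
  then have S: "L.subalgebra S" "vec.subspace S" "vec.dim S = 3"
    by (auto simp: L.subalgebras_of_dim_def L.subalgebra_def)
  show "S \<in> ?A \<union> ?B"
  proof (cases "L.abelian S")
    case True
    then obtain l m where lm: "(l, m) \<noteq> (0, 0)" "S \<subseteq> P32 l m"
      using S subspace_abelian_subset_P32 by blast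
    then have "S = P32 l m"
      using S dim_P32[OF lm(1)] by (intro vec.subspace_dim_equal) simp_all
    with lm show ?thesis by blast
  next
    case False
    then obtain l m where "P31 l m \<subseteq> S"
      using S subalgebra_nonabelian_superset_P31 by blast
    then have "P31 l m = S"
      using S dim_P31[of l m] by (intro vec.subspace_dim_equal) simp_all
    then show ?thesis by blast
  qed
next
  fix S :: "('a ^ 4) set" assume "S \<in> ?A \<union> ?B"
  then consider l m where "S = P31 l m" | l m where "(l, m) \<noteq> (0, 0)" "S = P32 l m"
    by blast
  then show "S \<in> L.subalgebras_of_dim 3"
    by cases (auto simp: L.subalgebras_of_dim_def subalgebra_if_e3 dim_P31 dim_P32)
qed

lemma proper_subalgebra_subset_dim3:
  fixes S :: "('a::field ^ 4) set"
  assumes S: "L.subalgebra S" and neq: "S \<noteq> UNIV"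
  obtains P where "P \<in> L.subalgebras_of_dim 3" "S \<subseteq> P"
proof (cases "L.abelian S")
  case True
  then obtain l m where "(l, m) \<noteq> (0, 0)" "S \<subseteq> P32 l m"
    using S subspace_abelian_subset_P32[of S] unfolding L.subalgebra_def by metis
  then show ?thesis
    using that[of "P32 l m"] unfolding subalgebras_dim3 by blast
next
  case False
  then obtain l m where lm: "P31 l m \<subseteq> S"
    using S subalgebra_nonabelian_superset_P31 by blast
  have sub: "vec.subspace S"
    using S by (simp add: L.subalgebra_def)
  \<comment> \<open>A subspace of full dimension would be everything, so \<open>S\<close> has
    dimension at most 3 and cannot exceed the \<open>P31 l m\<close> that it contains.\<close>
  have "vec.dim S < vec.dim (UNIV :: ('a ^ 4) set)"
    using sub neq by (metis vec.subspace_dim_equal not_le subset_UNIV vec.subspace_UNIV)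
  then have "vec.dim S \<le> vec.dim (P31 l m)"
    by (simp add: dim_P31 card_cart_basis)
  then have "P31 l m = S"
    using lm sub by (intro vec.subspace_dim_equal) auto
  then show ?thesis
    using that[of S] unfolding subalgebras_dim3 by blast
qed

lemma subalgebra_dim2_abelian:
  assumes "B \<in> L.subalgebras_of_dim 2"
  shows "L.abelian B"
proof (rule ccontr)
  assume "\<not> L.abelian B"
  then obtain l m where "P31 l m \<subseteq> B"
    using assms subalgebra_nonabelian_superset_P31 unfolding L.subalgebras_of_dim_def by blast
  then have "vec.dim (P31 l m) \<le> vec.dim B"
    by (rule vec.dim_subset)
  then show False
    using assms by (simp add: dim_P31 L.subalgebras_of_dim_def)
qed

lemma abelian_P32: "L.abelian (P32 l m)"
  by (auto simp: L.abelian_def mem_P32_span L_bracket_def)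

lemma heisenberg_P31: "L.heisenberg (P31 l m)"
  unfolding L.heisenberg_def lie_isomorphic_def
proof (intro conjI exI)
  let ?f = "\<lambda>x. vector [x $ 1, x $ 2, x $ 3] :: 'a ^ 3"
  \<comment> \<open>The projection to the first three coordinates preserves brackets, which depend
    on the first two only; its inverse recovers coordinate 4 from the equation of
    \<open>P31 l m\<close>.\<close>
  let ?g = "\<lambda>y :: 'a ^ 3. y $ 1 *s e 1 + y $ 2 *s e 2 + y $ 3 *s e 3 + (l * y $ 1 + m * y $ 2) *s e 4"
  show "L.subalgebra (P31 l m)"
    by (simp add: subalgebra_if_e3)
  show "bij_betw ?f (P31 l m) UNIV"
    by (rule bij_betwI[where g = ?g])
      (auto simp: mem_P31 vec_eq_iff forall_3 forall_4)
qed (auto simp: vec_eq_iff forall_3 h3_bracket_def L_bracket_def axis_def)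

lemma subalgebra_subset_P32:
  assumes "vec.subspace S" "S \<subseteq> P32 l m"
  shows "L.subalgebra S"
proof -
  have "L_bracket x y = 0" if "x \<in> S" "y \<in> S" for x y
    using abelian_P32[of l m] assms(2) that unfolding L.abelian_def by blast
  then show ?thesis
    using assms(1) by (simp add: L.subalgebra_def vec.subspace_0)
qed

section \<open>Generation and adjacency in the comaximal graph\<close>

lemma subalgebra_generated: "L.subalgebra (L.generated X)"
  unfolding L.generated_def
proof (rule hull_in)
  fix T :: "('a ^ 4) set set"
  assume "Ball T L.subalgebra"
  then show "L.subalgebra (\<Inter>T)"
    by (auto simp: L.subalgebra_def intro!: vec.subspace_Inter)
qed

text \<open>A common three-dimensional subalgebra also contains the generated one, which is then
  proper. Conversely, a proper generated subalgebra lies in a three-dimensional one, which contains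
  both \<open>A\<close> and \<open>B\<close>.\<close>

lemma generated_eq_UNIV_iff:
  fixes A B :: "('a::field ^ 4) set"
  shows "L.generated (A \<union> B) = UNIV \<longleftrightarrow> \<not> (\<exists>P \<in> L.subalgebras_of_dim 3. A \<subseteq> P \<and> B \<subseteq> P)"
proof
  assume gen: "L.generated (A \<union> B) = UNIV"
  show "\<not> (\<exists>P \<in> L.subalgebras_of_dim 3. A \<subseteq> P \<and> B \<subseteq> P)"
  proof
    assume "\<exists>P \<in> L.subalgebras_of_dim 3. A \<subseteq> P \<and> B \<subseteq> P"
    then obtain P where P: "L.subalgebra P" "vec.dim P = 3" "A \<union> B \<subseteq> P"
      by (auto simp: L.subalgebras_of_dim_def)
    then have "L.generated (A \<union> B) \<subseteq> P"
      unfolding L.generated_def by (intro hull_minimal)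
    then have "P = UNIV"
      using gen by auto
    then show False
      using P(2) by (simp add: card_cart_basis)
  qed
next
  assume "\<not> (\<exists>P \<in> L.subalgebras_of_dim 3. A \<subseteq> P \<and> B \<subseteq> P)"
  moreover have "A \<union> B \<subseteq> L.generated (A \<union> B)"
    unfolding L.generated_def by (rule hull_subset)
  ultimately show "L.generated (A \<union> B) = UNIV"
    using proper_subalgebra_subset_dim3[OF subalgebra_generated[of "A \<union> B"]] by (metis Un_subset_iff order_trans)
qed

lemma comaximal_vertexI:
  fixes A :: "('a::field ^ 4) set"
  assumes "A \<in> L.subalgebras_of_dim n" "0 < n" "n < 4"
  shows "A \<in> verts L.comaximal_graph"
  using assms by (auto simp: L.subalgebras_of_dim_def L.comaximal_graph_def Let_def card_cart_basis)

text \<open>Adjacency also demands \<open>A \<noteq> B\<close>, but this comes for free: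
  \<open>A\<close> lies in some three-dimensional \<open>P\<close>, so for \<open>A = B\<close> both
  sides fail. The dimensions are parameters so that lines and planes are treated together.\<close>

lemma adjacent_iff:
  fixes A B :: "('a::field ^ 4) set"
  assumes "A \<in> L.subalgebras_of_dim n" "0 < n" "n < 3" "B \<in> L.subalgebras_of_dim k" "0 < k" "k < 4"
  shows "A \<rightarrow>\<^bsub>L.comaximal_graph\<^esub> B \<longleftrightarrow>
    \<not> (\<exists>P \<in> L.subalgebras_of_dim 3. A \<subseteq> P \<and> B \<subseteq> P)"
proof -
  have "L.subalgebra A" "A \<noteq> UNIV"
    using assms by (auto simp: L.subalgebras_of_dim_def card_cart_basis)
  then obtain P where "P \<in> L.subalgebras_of_dim 3" "A \<subseteq> P"
    by (rule proper_subalgebra_subset_dim3)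
  then show ?thesis
    using comaximal_vertexI[OF assms(1)] comaximal_vertexI[OF assms(4)] assms
    unfolding L.comaximal_graph_adj generated_eq_UNIV_iff by auto
qed

text \<open>A common three-dimensional subalgebra would have to equal both \<open>A\<close> and
  \<open>B\<close> by dimension.\<close>

lemma adjacent_dim3:
  fixes A B :: "('a::field ^ 4) set"
  assumes A: "A \<in> L.subalgebras_of_dim 3" and B: "B \<in> L.subalgebras_of_dim 3" and "A \<noteq> B"
  shows "A \<rightarrow>\<^bsub>L.comaximal_graph\<^esub> B"
proof -
  have "C = P" if "C \<in> L.subalgebras_of_dim 3" "P \<in> L.subalgebras_of_dim 3" "C \<subseteq> P" for C P :: "('a ^ 4) set"
    using that by (intro vec.subspace_dim_equal) (auto simp: L.subalgebras_of_dim_def L.subalgebra_def)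
  then have "\<not> (\<exists>P \<in> L.subalgebras_of_dim 3. A \<subseteq> P \<and> B \<subseteq> P)"
    using assms by blast
  then show ?thesis
    using assms comaximal_vertexI[of A 3] comaximal_vertexI[of B 3]
    by (simp add: L.comaximal_graph_adj generated_eq_UNIV_iff)
qed

lemma complete_graph_dim3:
  assumes "finite (L.subalgebras_of_dim 3 :: ('a::field ^ 4) set set)"
  shows "K\<^bsub>card (L.subalgebras_of_dim 3 :: ('a ^ 4) set set)\<^esub>
    ((L.comaximal_graph :: (('a ^ 4) set, _) pre_digraph) \<restriction> L.subalgebras_of_dim 3)"
proof -
  let ?V = "L.subalgebras_of_dim 3 :: ('a ^ 4) set set"
  have arc: "(A, B) \<in> arcs L.comaximal_graph \<longleftrightarrow> A \<rightarrow>\<^bsub>L.comaximal_graph\<^esub> B" for A B :: "('a ^ 4) set"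
    unfolding L.comaximal_graph_adj by (auto simp: L.comaximal_graph_def Let_def)
  have proj: "tail L.comaximal_graph = (fst :: ('a ^ 4) set \<times> _ \<Rightarrow> _)"
    "head L.comaximal_graph = (snd :: ('a ^ 4) set \<times> _ \<Rightarrow> _)"
    by (simp_all add: L.comaximal_graph_def Let_def)
  have "A \<rightarrow>\<^bsub>L.comaximal_graph\<^esub> B \<longleftrightarrow> A \<noteq> B" if "A \<in> ?V" "B \<in> ?V" for A B :: "('a ^ 4) set"
    using adjacent_dim3[OF that] unfolding L.comaximal_graph_adj by blast
  then have "{a \<in> arcs L.comaximal_graph. fst a \<in> ?V \<and> snd a \<in> ?V} = {(A, B). (A, B) \<in> ?V \<times> ?V \<and> A \<noteq> B}"
    by (auto simp only: arc mem_Collect_eq split_paired_all fst_conv snd_conv case_prod_conv mem_Sigma_iff)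
  \<comment> \<open>Writing the induced subgraph as a pair digraph with explicit arcs makes
    \<open>complete_digraph_pair_def\<close> applicable.\<close>
  then have "(L.comaximal_graph :: (('a ^ 4) set, _) pre_digraph) \<restriction> ?V =
      with_proj \<lparr>pverts = ?V, parcs = {(A, B). (A, B) \<in> ?V \<times> ?V \<and> A \<noteq> B}\<rparr>"
    by (simp add: induce_subgraph_def proj with_proj_def)
  then show ?thesis
    using assms by (simp add: complete_digraph_pair_def)
qed

section \<open>Two-dimensional subalgebras and the hyperplanes containing them\<close>

lemma dim2_not_maximal:
  fixes M :: "('a::field ^ 4) set"
  assumes "M \<in> L.subalgebras_of_dim 2"
  shows "\<not> L.maximal_subalgebra M"
proof
  assume max: "L.maximal_subalgebra M"
  then obtain P where P: "P \<in> L.subalgebras_of_dim 3" "M \<subseteq> P"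
    using proper_subalgebra_subset_dim3 unfolding L.maximal_subalgebra_def by metis
  then have "P = M \<or> P = UNIV"
    using max by (auto simp: L.maximal_subalgebra_def L.subalgebras_of_dim_def)
  then show False
    using P(1) assms by (auto simp: L.subalgebras_of_dim_def card_cart_basis)
qed

lemma dim2_subset_P32:
  assumes "B \<in> L.subalgebras_of_dim 2"
  obtains l m where "(l, m) \<noteq> (0, 0)" "B \<subseteq> P32 l m"
  using subspace_abelian_subset_P32[of B] subalgebra_dim2_abelian[OF assms] assms
  unfolding L.subalgebras_of_dim_def L.subalgebra_def by blast

text \<open>\<open>B\<close> is abelian, so it also lies in some \<open>P32 a b\<close>. The
  intersection of the two hyperplanes is already a plane, hence equal to \<open>B\<close>.\<close>

lemma dim2_subset_P31:
  assumes B: "B \<in> L.subalgebras_of_dim 2" and "B \<subseteq> P31 l m"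
  obtains a b c where "(a, b, c) \<noteq> (0, 0, 0)" "B = Pe3 a b c"
proof -
  obtain a b where ab: "(a, b) \<noteq> (0, 0)" "B \<subseteq> P32 a b"
    using B by (rule dim2_subset_P32)
  \<comment> \<open>Over the direction \<open>(a, b)\<close> the equation of \<open>P31 l m\<close>
    forces coordinate 4 to be this combination.\<close>
  have "B \<subseteq> Pe3 a b (l * a + m * b)"
    using ab(2) assms(2) by (force simp: subset_iff mem_P31 mem_P32_span mem_Pe3 algebra_simps)
  moreover have "vec.dim (Pe3 a b (l * a + m * b)) = 2"
    using ab(1) by (intro dim_Pe3) auto
  ultimately have "B = Pe3 a b (l * a + m * b)"
    using B by (intro vec.subspace_dim_equal) (auto simp: L.subalgebras_of_dim_def L.subalgebra_def)
  then show ?thesis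
    using that ab(1) by blast
qed

lemma Pe3_dim2: "(a, b, c) \<noteq> (0, 0, 0) \<Longrightarrow> Pe3 a b c \<in> L.subalgebras_of_dim 2"
  unfolding L.subalgebras_of_dim_def by (simp add: subalgebra_if_e3 dim_Pe3)

section \<open>Projective representatives\<close>

text \<open>Representatives of the points of the projective line and plane, normalised so that the first
  nonzero coordinate is \<open>1\<close>.\<close>

definition proj_line :: "('a::field \<times> 'a) set" where
  "proj_line = insert (0, 1) (range (Pair 1))"

definition proj_plane :: "('a::field \<times> 'a \<times> 'a) set" where
  "proj_plane = Pair 0 ` proj_line \<union> range (Pair 1)"

lemma finite_proj_line: "finite (UNIV :: 'a::field set) \<Longrightarrow> finite (proj_line :: ('a \<times> 'a) set)"
  by (simp add: proj_line_def)

lemma card_proj_line: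
  assumes "finite (UNIV :: 'a::field set)"
  shows "card (proj_line :: ('a \<times> 'a) set) = CARD('a) + 1"
  using assms by (simp add: proj_line_def card_insert_disjoint image_iff card_image inj_on_def)

text \<open>The projective plane splits into a line at infinity, where the first coordinate is 0,
  and an affine plane.\<close>

lemma card_proj_plane:
  assumes "finite (UNIV :: 'a::field set)"
  shows "card (proj_plane :: ('a \<times> 'a \<times> 'a) set) = CARD('a) ^ 2 + CARD('a) + 1"
proof -
  have "finite (proj_line :: ('a \<times> 'a) set)" "finite (UNIV :: ('a \<times> 'a) set)"
    using assms by (simp_all add: proj_line_def finite_Prod_UNIV)
  moreover have "Pair (0 :: 'a) ` (proj_line :: ('a \<times> 'a) set) \<inter> range (Pair 1) = {}"
    by auto
  ultimately have "card (proj_plane :: ('a \<times> 'a \<times> 'a) set) =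
      card (Pair (0 :: 'a) ` (proj_line :: ('a \<times> 'a) set)) + card (range (Pair (1 :: 'a)) :: ('a \<times> 'a \<times> 'a) set)"
    unfolding proj_plane_def
    by (simp only: card_Un_disjoint finite_imageI)
  also have "\<dots> = (CARD('a) + 1) + CARD('a \<times> 'a)"
    using assms by (simp add: card_image inj_on_def card_proj_line)
  finally show ?thesis
    by (simp add: card_prod power2_eq_square)
qed

lemma proj_line_nonzero: "(l, m) \<in> proj_line \<Longrightarrow> (l, m) \<noteq> (0, 0)"
  by (auto simp: proj_line_def)

lemma proj_line_normalize:
  assumes "(l, m) \<noteq> (0, 0)"
  obtains k l' m' where "k \<noteq> 0" "(l', m') \<in> proj_line" "l = k * l'" "m = k * m'"
proof (cases "l = 0")
  case True
  then show ?thesis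
    using assms that[of m 0 1] by (simp add: proj_line_def)
next
  case False
  then show ?thesis
    using that[of l 1 "m / l"] by (simp add: proj_line_def)
qed

lemma proj_plane_nonzero: "(a, b, c) \<in> proj_plane \<Longrightarrow> (a, b, c) \<noteq> (0, 0, 0)"
  by (auto simp: proj_plane_def proj_line_def)

lemma proj_plane_normalize:
  assumes "(a, b, c) \<noteq> (0, 0, 0)"
  obtains k a' b' c' where "k \<noteq> 0" "(a', b', c') \<in> proj_plane" "a = k * a'" "b = k * b'" "c = k * c'"
proof (cases "a = 0")
  case True
  then obtain k b' c' where "k \<noteq> 0" "(b', c') \<in> proj_line" "b = k * b'" "c = k * c'"
    using assms proj_line_normalize[of b c] by auto
  then show ?thesis
    using that[of k 0 b' c'] True by (simp add: proj_plane_def)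
next
  case False
  then show ?thesis
    using that[of a 1 "b / a" "c / a"] by (simp add: proj_plane_def)
qed

text \<open>The first nonzero coordinate of both pairs is 1, which leaves no freedom for the scalar.
  That \<open>k = 1\<close> is used to compare the affine parameters of planes.\<close>

lemma proj_line_proportional:
  assumes "(l, m) \<in> proj_line" "(l', m') \<in> proj_line" "l = k * l'" "m = k * m'"
  shows "l = l' \<and> m = m' \<and> k = 1"
  using assms by (auto simp: proj_line_def)

lemma proj_plane_proportional:
  assumes "(a, b, c) \<in> proj_plane" "(a', b', c') \<in> proj_plane" "a = k * a'" "b = k * b'" "c = k * c'"
  shows "a = a' \<and> b = b' \<and> c = c'"
  using assms by (auto simp: proj_plane_def proj_line_def)

text \<open>Only the projective point of \<open>(l, m)\<close> matters, so normalised
  representatives suffice for counting.\<close>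

lemma P32_scale:
  assumes "k \<noteq> 0"
  shows "P32 (k * l) (k * m) = P32 l m"
proof -
  have "x \<in> P32 (k * l) (k * m)" if "x \<in> P32 l m" for x
  proof -
    from that obtain j where "x $ 1 = j * l" "x $ 2 = j * m"
      by (auto simp: mem_P32_span)
    then show ?thesis
      using assms by (auto simp: mem_P32_span intro!: exI[of _ "j / k"])
  qed
  then show ?thesis
    by (auto simp: mem_P32_span mult.assoc[symmetric])
qed

lemma Pe3_scale:
  assumes "k \<noteq> 0"
  shows "Pe3 (k * a) (k * b) (k * c) = Pe3 a b c"
proof -
  have "x \<in> Pe3 (k * a) (k * b) (k * c)" if "x \<in> Pe3 a b c" for x
  proof -
    from that obtain j where "x $ 1 = j * a" "x $ 2 = j * b" "x $ 4 = j * c"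
      by (auto simp: mem_Pe3)
    then show ?thesis
      using assms by (auto simp: mem_Pe3 intro!: exI[of _ "j / k"])
  qed
  then show ?thesis
    by (auto simp: mem_Pe3 mult.assoc[symmetric])
qed

section \<open>Cardinalities of the parametrised families\<close>

lemma P31_eq_image: "{P31 l m | l m. True} = range (\<lambda>(l, m). P31 l m)"
  by auto

lemma card_P31: "card {P31 l m | l m :: 'a::field. True} = CARD('a) ^ 2"
proof -
  have "inj (\<lambda>(l, m). P31 l m :: ('a ^ 4) set)"
  proof (rule injI, clarify)
    fix l m l' m' :: 'a
    assume "P31 l m = P31 l' m'"
    moreover have "e 1 + l *s e 4 \<in> P31 l m" "e 2 + m *s e 4 \<in> P31 l m"
      by (simp_all add: mem_P31)
    ultimately have "e 1 + l *s e 4 \<in> P31 l' m'" "e 2 + m *s e 4 \<in> P31 l' m'"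
      by simp_all
    then show "l = l' \<and> m = m'"
      by (simp add: mem_P31)
  qed
  \<comment> \<open>Over an infinite field both sides are 0, by the convention for
    \<open>card\<close> on infinite sets.\<close>
  then have "card (range (\<lambda>(l, m). P31 l m :: ('a ^ 4) set)) = CARD('a \<times> 'a)"
    by (rule card_image)
  then show ?thesis
    by (simp only: P31_eq_image card_prod power2_eq_square)
qed

lemma P32_eq_image: "{P32 l m | l m. (l, m) \<noteq> (0, 0)} = (\<lambda>(l, m). P32 l m) ` proj_line"
proof (intro equalityI subsetI)
  fix S assume "S \<in> {P32 l m | l m. (l, m) \<noteq> (0, 0)}"
  then obtain l m where "(l, m) \<noteq> (0, 0)" "S = P32 l m"
    by blast
  moreover from this(1) obtain k l' m' where "k \<noteq> 0" "(l', m') \<in> proj_line" "l = k * l'" "m = k * m'"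
    by (rule proj_line_normalize)
  ultimately show "S \<in> (\<lambda>(l, m). P32 l m) ` proj_line"
    by (auto simp: P32_scale)
next
  fix S assume "S \<in> (\<lambda>(l, m). P32 l m) ` proj_line"
  then obtain l m where "(l, m) \<in> proj_line" "S = P32 l m"
    by auto
  then show "S \<in> {P32 l m | l m. (l, m) \<noteq> (0, 0)}"
    using proj_line_nonzero by blast
qed

lemma card_P32:
  assumes "finite (UNIV :: 'a::field set)"
  shows "card {P32 l m | l m :: 'a. (l, m) \<noteq> (0, 0)} = CARD('a) + 1"
proof -
  have "inj_on (\<lambda>(l, m). P32 l m :: ('a ^ 4) set) proj_line"
  proof (rule inj_onI, clarify)
    fix l m l' m' :: 'a
    assume *: "(l, m) \<in> proj_line" "(l', m') \<in> proj_line" "P32 l m = P32 l' m'"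
    have "l *s e 1 + m *s e 2 \<in> P32 l m"
      by (auto simp: mem_P32_span intro: exI[of _ 1])
    then obtain k where "l = k * l'" "m = k * m'"
      unfolding *(3) by (auto simp: mem_P32_span)
    then show "l = l' \<and> m = m'"
      using * proj_line_proportional by blast
  qed
  then show ?thesis
    by (simp only: P32_eq_image card_image card_proj_line[OF assms])
qed

lemma Pe3_eq_image:
  "{Pe3 a b c | a b c. (a, b, c) \<noteq> (0, 0, 0)} = (\<lambda>(a, b, c). Pe3 a b c) ` proj_plane"
proof (intro equalityI subsetI)
  fix S assume "S \<in> {Pe3 a b c | a b c. (a, b, c) \<noteq> (0, 0, 0)}"
  then obtain a b c where "(a, b, c) \<noteq> (0, 0, 0)" "S = Pe3 a b c"
    by blast
  moreover from this(1) obtain k a' b' c'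
    where "k \<noteq> 0" "(a', b', c') \<in> proj_plane" "a = k * a'" "b = k * b'" "c = k * c'"
    by (rule proj_plane_normalize)
  ultimately show "S \<in> (\<lambda>(a, b, c). Pe3 a b c) ` proj_plane"
    by (auto simp: Pe3_scale)
next
  fix S assume "S \<in> (\<lambda>(a, b, c). Pe3 a b c) ` proj_plane"
  then obtain a b c where "(a, b, c) \<in> proj_plane" "S = Pe3 a b c"
    by auto
  then show "S \<in> {Pe3 a b c | a b c. (a, b, c) \<noteq> (0, 0, 0)}"
    using proj_plane_nonzero by blast
qed

lemma card_Pe3:
  assumes "finite (UNIV :: 'a::field set)"
  shows "card {Pe3 a b c | a b c :: 'a. (a, b, c) \<noteq> (0, 0, 0)} = CARD('a) ^ 2 + CARD('a) + 1"
proof -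
  have "inj_on (\<lambda>(a, b, c). Pe3 a b c :: ('a ^ 4) set) proj_plane"
  proof (rule inj_onI, simp only: split_paired_all case_prod_conv prod.inject)
    fix a b c a' b' c' :: 'a
    assume *: "(a, b, c) \<in> proj_plane" "(a', b', c') \<in> proj_plane" "Pe3 a b c = Pe3 a' b' c'"
    have "a *s e 1 + b *s e 2 + c *s e 4 \<in> Pe3 a b c"
      by (auto simp: mem_Pe3 intro: exI[of _ 1])
    then obtain k where "a = k * a'" "b = k * b'" "c = k * c'"
      unfolding *(3) by (auto simp: mem_Pe3)
    then show "a = a' \<and> b = b' \<and> c = c'"
      using * proj_plane_proportional by blast
  qed
  then show ?thesis
    by (simp only: Pe3_eq_image card_image card_proj_plane[OF assms])
qed

text \<open>The central vector \<open>e 4\<close> separates the two types.\<close>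

lemma P31_P32_disjoint: "(l', m') \<noteq> (0, 0) \<Longrightarrow> P31 l m \<noteq> P32 l' m'"
proof -
  have "e 4 \<in> P32 l' m'" "e 4 \<notin> P31 l m"
    by (auto simp: mem_P31 mem_P32_span intro: exI[of _ 0])
  then show ?thesis by metis
qed

lemma card_dim3:
  assumes fin: "finite (UNIV :: 'a::field set)"
  shows "finite (L.subalgebras_of_dim 3 :: ('a ^ 4) set set)"
    and "card (L.subalgebras_of_dim 3 :: ('a ^ 4) set set) = CARD('a) ^ 2 + CARD('a) + 1"
proof -
  have fin: "finite {P31 l m | l m :: 'a. True}" "finite {P32 l m | l m :: 'a. (l, m) \<noteq> (0, 0)}"
    using fin by (simp_all only: P31_eq_image P32_eq_image finite_imageI finite_proj_line finite_Prod_UNIV)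
  then show "finite (L.subalgebras_of_dim 3 :: ('a ^ 4) set set)"
    by (simp add: subalgebras_dim3)
  have "{P31 l m | l m :: 'a. True} \<inter> {P32 l m | l m :: 'a. (l, m) \<noteq> (0, 0)} = {}"
    using P31_P32_disjoint by blast
  then show "card (L.subalgebras_of_dim 3 :: ('a ^ 4) set set) = CARD('a) ^ 2 + CARD('a) + 1"
    using fin card_P31[where 'a='a] card_P32[OF assms]
    by (simp only: subalgebras_dim3 card_Un_disjoint)
qed

lemma Pe3_subset_P32:
  assumes "(a, b, c) \<noteq> (0, 0, 0)"
  obtains l m where "(l, m) \<noteq> (0, 0)" "Pe3 a b c \<subseteq> P32 l m"
  using dim2_subset_P32[OF Pe3_dim2[OF assms]] .

section \<open>Counting the planes inside the abelian hyperplanes\<close>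

text \<open>The functional \<open>(p, r)\<close> on \<open>Z\<close> has the line \<open>B \<inter> Z\<close> as its kernel, and \<open>t\<close> is its value on the
  last two coordinates of any element of the plane \<open>B\<close> lying over \<open>(l, m)\<close>.\<close>

definition transversal_plane :: "('a::field \<times> 'a) \<times> ('a \<times> 'a) \<times> 'a \<Rightarrow> ('a ^ 4) set" where
  "transversal_plane = (\<lambda>((l, m), (p, r), t).
     {x. \<exists>k. x $ 1 = k * l \<and> x $ 2 = k * m \<and> p * x $ 3 + r * x $ 4 = k * t})"

text \<open>Subtracting a multiple of \<open>u\<close>, a point over \<open>(l, m)\<close>, moves
  any element into the kernel of \<open>(p, r)\<close> on \<open>Z\<close>, and that kernel is the
  line through \<open>z\<close>.\<close>

lemma transversal_plane_eq_span:
  assumes pr: "(p, r) \<noteq> (0, 0)"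
    and u: "u $ 1 = l" "u $ 2 = m" "p * u $ 3 + r * u $ 4 = t"
    and z: "z \<in> Z" "z \<noteq> 0" "p * z $ 3 + r * z $ 4 = 0"
  shows "transversal_plane ((l, m), (p, r), t) = vec.span {u, z}"
proof (intro equalityI subsetI)
  fix x assume "x \<in> transversal_plane ((l, m), (p, r), t)"
  then obtain k where k: "x $ 1 = k * l" "x $ 2 = k * m" "p * x $ 3 + r * x $ 4 = k * t"
    by (auto simp: transversal_plane_def)
  define y where "y = x - k *s u"
  have "p * y $ 3 + r * y $ 4 = (p * x $ 3 + r * x $ 4) - k * (p * u $ 3 + r * u $ 4)"
    by (simp add: y_def algebra_simps)
  then have y: "y $ 1 = 0" "y $ 2 = 0" "p * y $ 3 + r * y $ 4 = 0"
    using k u by (simp_all add: y_def)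
  \<comment> \<open>Both \<open>y\<close> and \<open>z\<close> are killed by the nonzero functional
    \<open>(p, r)\<close>, so their last two coordinates are proportional. The case split finds a
    nonzero coefficient to cancel.\<close>
  have "z $ 4 * y $ 3 = z $ 3 * y $ 4"
  proof (cases "p = 0")
    case True
    then show ?thesis
      using pr y(3) z(3) by simp
  next
    case False
    have "p * (z $ 4 * y $ 3) = z $ 4 * (p * y $ 3)"
      by simp
    also have "p * y $ 3 = - (r * y $ 4)"
      using y(3) by (simp add: eq_neg_iff_add_eq_0)
    also have "z $ 4 * - (r * y $ 4) = - (r * z $ 4) * y $ 4"
      by simp
    also have "- (r * z $ 4) = p * z $ 3"
      using z(3) by (simp add: eq_neg_iff_add_eq_0 neg_eq_iff_add_eq_0 add.commute)
    finally show ?thesis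
      using False by simp
  qed
  moreover have "(z $ 3, z $ 4) \<noteq> (0, 0)"
    using z(1,2) by (auto simp: mem_Z vec4_eq_iff)
  ultimately obtain j where "y $ 3 = j * z $ 3" "y $ 4 = j * z $ 4"
    using proportional_iff by blast
  then have "x - k *s u - j *s z = 0"
    using y z(1) by (simp add: vec4_eq_iff mem_Z y_def)
  then show "x \<in> vec.span {u, z}"
    unfolding mem_span_insert vec.span_empty by blast
next
  fix x assume "x \<in> vec.span {u, z}"
  then obtain k j where "x - k *s u - j *s z = 0"
    unfolding mem_span_insert vec.span_empty by blast
  then have x: "x = k *s u + j *s z"
    by (simp add: algebra_simps)
  have "p * x $ 3 + r * x $ 4 = k * (p * u $ 3 + r * u $ 4) + j * (p * z $ 3 + r * z $ 4)"
    by (simp add: x algebra_simps)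
  then show "x \<in> transversal_plane ((l, m), (p, r), t)"
    using u z by (auto simp: transversal_plane_def x mem_Z)
qed

lemma dim_span_pair:
  assumes "u \<notin> Z" "z \<in> Z" "z \<noteq> 0"
  shows "vec.dim (vec.span {u, z}) = 2"
proof -
  have "vec.span {z} \<subseteq> Z"
    using assms by (intro vec.span_minimal) auto
  then have "u \<notin> vec.span {z}"
    using assms by blast
  then show ?thesis
    using assms by (simp add: vec.dim_insert)
qed

lemma transversal_plane_points:
  fixes l m p r t :: "'a::field"
  assumes "(p, r) \<noteq> (0, 0)"
  obtains u :: "'a ^ 4" where "u $ 1 = l" "u $ 2 = m" "p * u $ 3 + r * u $ 4 = t"
proof (cases "p = 0")
  case True
  then show ?thesis
    using assms that[of "l *s e 1 + m *s e 2 + (t / r) *s e 4"] by simp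
next
  case False
  then show ?thesis
    using that[of "l *s e 1 + m *s e 2 + (t / p) *s e 3"] by simp
qed

lemma transversal_plane_dim2:
  fixes l m p r t :: "'a::field"
  assumes lm: "(l, m) \<noteq> (0, 0)" and pr: "(p, r) \<noteq> (0, 0)"
  shows "transversal_plane ((l, m), (p, r), t) \<in> L.subalgebras_of_dim 2"
    and "transversal_plane ((l, m), (p, r), t) \<subseteq> P32 l m"
    and "transversal_plane ((l, m), (p, r), t) \<noteq> Z"
proof -
  obtain u :: "'a ^ 4" where u: "u $ 1 = l" "u $ 2 = m" "p * u $ 3 + r * u $ 4 = t"
    using pr by (rule transversal_plane_points)
  \<comment> \<open>This vector spans the kernel of the functional \<open>(p, r)\<close> on
    \<open>Z\<close>.\<close>
  define z where "z = r *s e 3 - p *s e 4"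
  have z: "z \<in> Z" "z \<noteq> 0" "p * z $ 3 + r * z $ 4 = 0"
    using pr by (auto simp: z_def mem_Z vec4_eq_iff)
  have eq: "transversal_plane ((l, m), (p, r), t) = vec.span {u, z}"
    using pr u z by (rule transversal_plane_eq_span)
  have "u \<notin> Z"
    using u lm by (auto simp: mem_Z)
  then have dim: "vec.dim (transversal_plane ((l, m), (p, r), t)) = 2"
    unfolding eq using z by (intro dim_span_pair)
  show "transversal_plane ((l, m), (p, r), t) \<noteq> Z"
    using eq \<open>u \<notin> Z\<close> vec.span_base[of u "{u, z}"] by auto
  show sub: "transversal_plane ((l, m), (p, r), t) \<subseteq> P32 l m"
    by (auto simp: transversal_plane_def mem_P32_span)
  have "vec.subspace (transversal_plane ((l, m), (p, r), t))"
    by (simp add: eq)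
  then show "transversal_plane ((l, m), (p, r), t) \<in> L.subalgebras_of_dim 2"
    using sub dim subalgebra_subset_P32 unfolding L.subalgebras_of_dim_def by blast
qed

text \<open>By dimension \<open>B\<close> is not inside \<open>Z\<close>, so it has a basis of one
  vector \<open>u\<close> over \<open>(l, m)\<close> and one vector \<open>z\<close> in
  \<open>Z\<close>. The parameters are read off from this basis.\<close>

lemma subspace_dim2_transversal_plane:
  fixes B :: "('a::field ^ 4) set"
  assumes B: "vec.subspace B" "vec.dim B = 2" and lm: "B \<subseteq> P32 l m" and Z: "B \<noteq> Z"
  obtains p r t where "(p, r) \<in> proj_line" "B = transversal_plane ((l, m), (p, r), t)"
proof -
  have "\<not> B \<subseteq> Z"
    using vec.subspace_dim_equal[of B Z] B Z by (auto simp: dim_Z)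
  then obtain w where w: "w \<in> B" "w \<notin> Z"
    by blast
  then obtain k where k: "w $ 1 = k * l" "w $ 2 = k * m"
    using lm mem_P32_span by blast
  then have "k \<noteq> 0"
    using w by (auto simp: mem_Z)
  define u where "u = inverse k *s w"
  have u: "u \<in> B" "u $ 1 = l" "u $ 2 = m"
    using w k \<open>k \<noteq> 0\<close> B(1) by (simp_all add: u_def vec.subspace_scale)
  have "u \<notin> Z"
    using w(2) k u(2,3) by (auto simp: mem_Z)
  have "vec.dim (vec.span {u}) < vec.dim B"
    using B(2) by simp
  then have "\<not> B \<subseteq> vec.span {u}"
    using vec.dim_subset leD by blast
  then obtain v where v: "v \<in> B" "v \<notin> vec.span {u}"
    by blast
  then obtain j where j: "v $ 1 = j * l" "v $ 2 = j * m"
    using lm mem_P32_span by blast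
  define z where "z = v - j *s u"
  have z: "z \<in> B" "z \<in> Z"
    using v(1) j u B(1) by (simp_all add: z_def mem_Z vec.subspace_diff vec.subspace_scale)
  have "z \<noteq> 0"
    using v(2) by (auto simp: z_def mem_span_insert)
  \<comment> \<open>As a functional on \<open>Z\<close>, this pair annihilates \<open>z\<close>; its
    normalised form is the required \<open>(p, r)\<close>, and \<open>t\<close> is its value on
    \<open>u\<close>.\<close>
  with z(2) have "(z $ 4, - z $ 3) \<noteq> (0, 0)"
    by (auto simp: mem_Z vec4_eq_iff)
  then obtain c p r where pr: "c \<noteq> 0" "(p, r) \<in> proj_line" "z $ 4 = c * p" "- z $ 3 = c * r"
    by (rule proj_line_normalize)
  have "z $ 3 = - (c * r)"
    using pr(4) by (metis minus_minus)
  then have "p * z $ 3 + r * z $ 4 = 0"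
    using pr(3) by simp
  then have eq: "transversal_plane ((l, m), (p, r), p * u $ 3 + r * u $ 4) = vec.span {u, z}"
    using proj_line_nonzero[OF pr(2)] u z \<open>z \<noteq> 0\<close> by (intro transversal_plane_eq_span) simp_all
  have "vec.span {u, z} = B"
    using u z B dim_span_pair[OF \<open>u \<notin> Z\<close> z(2) \<open>z \<noteq> 0\<close>]
    by (intro vec.subspace_dim_equal vec.span_minimal) simp_all
  then show ?thesis
    using that pr(2) eq by metis
qed

text \<open>The plane determines each parameter in turn: its projection gives \<open>(l, m)\<close>,
  its intersection with \<open>Z\<close> gives \<open>(p, r)\<close>, and the functional on a point
  over \<open>(l, m)\<close> gives \<open>t\<close>.\<close>

lemma inj_on_transversal_plane: "inj_on transversal_plane (proj_line \<times> proj_line \<times> UNIV)"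
proof (rule inj_onI, simp only: split_paired_all mem_Sigma_iff prod.inject)
  fix l m p r t l' m' p' r' t' :: 'a
  assume "(l, m) \<in> proj_line \<and> (p, r) \<in> proj_line \<and> t \<in> UNIV"
    and "(l', m') \<in> proj_line \<and> (p', r') \<in> proj_line \<and> t' \<in> UNIV"
    and eq: "transversal_plane ((l, m), (p, r), t) = transversal_plane ((l', m'), (p', r'), t')"
  then have pts: "(l, m) \<in> proj_line" "(p, r) \<in> proj_line" "(l', m') \<in> proj_line" "(p', r') \<in> proj_line"
    by simp_all
  obtain u :: "'a ^ 4" where u: "u $ 1 = l" "u $ 2 = m" "p * u $ 3 + r * u $ 4 = t"
    using proj_line_nonzero[OF pts(2)] by (rule transversal_plane_points)
  then have "u \<in> transversal_plane ((l, m), (p, r), t)"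
    by (auto simp: transversal_plane_def intro: exI[of _ 1])
  then obtain k where k: "l = k * l'" "m = k * m'" "p' * u $ 3 + r' * u $ 4 = k * t'"
    unfolding eq by (auto simp: transversal_plane_def u)
  then have lm: "l = l'" "m = m'" "k = 1"
    using proj_line_proportional pts by blast+
  \<comment> \<open>The kernel vector has zero projection, so its scalar in the second description
    is 0 too, and \<open>(p', r')\<close> must annihilate it.\<close>
  have "r *s e 3 - p *s e 4 \<in> transversal_plane ((l, m), (p, r), t)"
    by (auto simp: transversal_plane_def intro: exI[of _ 0])
  then have "p' * r = r' * p"
    unfolding eq using proj_line_nonzero[OF pts(3)] by (auto simp: transversal_plane_def)
  then have pr: "p = p'" "r = r'"
    using pts by (auto simp: proj_line_def)
  show "((l = l' \<and> m = m') \<and> (p = p' \<and> r = r') \<and> t = t')"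
    using lm pr u(3) k(3) by simp
qed

text \<open>\<open>Z\<close> is listed separately because its projection to the coordinates 1 and 2
  is zero and hence determines no projective point.\<close>

lemma dim2_in_P32_eq:
  "{B \<in> L.subalgebras_of_dim 2. \<exists>l m. (l, m) \<noteq> (0, 0) \<and> B \<subseteq> P32 l m} =
    insert Z (transversal_plane ` (proj_line \<times> proj_line \<times> UNIV))"
  (is "?A = ?B")
proof (intro equalityI subsetI)
  fix S :: "('a ^ 4) set" assume "S \<in> ?A"
  then obtain l m where S: "vec.subspace S" "vec.dim S = 2" "(l, m) \<noteq> (0, 0)" "S \<subseteq> P32 l m"
    by (auto simp: L.subalgebras_of_dim_def L.subalgebra_def)
  obtain k l' m' where k: "k \<noteq> 0" "(l', m') \<in> proj_line" "l = k * l'" "m = k * m'"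
    using S(3) by (rule proj_line_normalize)
  show "S \<in> ?B"
  proof (cases "S = Z")
    case False
    have "S \<subseteq> P32 l' m'"
      using S(4) k P32_scale by blast
    then obtain p r t where "(p, r) \<in> proj_line" "S = transversal_plane ((l', m'), (p, r), t)"
      using subspace_dim2_transversal_plane S False by metis
    then show ?thesis
      using k(2) by blast
  qed simp
next
  fix S :: "('a ^ 4) set" assume "S \<in> ?B"
  then consider "S = Z" | l m p r t where "(l, m) \<in> proj_line" "(p, r) \<in> proj_line"
      "S = transversal_plane ((l, m), (p, r), t)"
    by auto
  then show "S \<in> ?A"
  proof cases
    case 1
    have sub: "Z \<subseteq> P32 (1 :: 'a) 0"
      by (auto simp: mem_Z mem_P32_span)
    then have "L.subalgebra (Z :: ('a ^ 4) set)"
      by (rule subalgebra_subset_P32[OF subspace_P(4)])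
    then have "S \<in> L.subalgebras_of_dim 2"
      by (simp add: 1 L.subalgebras_of_dim_def dim_Z)
    moreover have "\<exists>l m. (l, m) \<noteq> (0, 0) \<and> S \<subseteq> P32 l m"
      unfolding 1 using sub by (intro exI[of _ 1] exI[of _ 0]) simp
    ultimately show ?thesis
      by (intro CollectI conjI)
  next
    case 2
    note lm = proj_line_nonzero[OF 2(1)] and pr = proj_line_nonzero[OF 2(2)]
    show ?thesis
      unfolding 2(3) using transversal_plane_dim2(1,2)[OF lm pr] lm by (intro CollectI conjI exI)
  qed
qed

text \<open>With q the order of the field, there are q + 1 projections, q + 1 intersections with
  \<open>Z\<close> and q values of \<open>t\<close>; adding \<open>Z\<close> gives q (q + 1)^2 +
  1.\<close>

lemma card_dim2_in_P32:
  assumes fin: "finite (UNIV :: 'a::field set)"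
  shows "card {B \<in> L.subalgebras_of_dim 2. \<exists>l m :: 'a. (l, m) \<noteq> (0, 0) \<and> B \<subseteq> P32 l m} =
    CARD('a) ^ 3 + 2 * CARD('a) ^ 2 + CARD('a) + 1"
proof -
  let ?I = "proj_line \<times> proj_line \<times> UNIV :: (('a \<times> 'a) \<times> ('a \<times> 'a) \<times> 'a) set"
  have "Z \<noteq> transversal_plane i" if i: "i \<in> ?I" for i
  proof -
    obtain l m p r t where "i = ((l, m), (p, r), t)"
      by (metis surj_pair)
    then show ?thesis
      using i transversal_plane_dim2(3)[OF proj_line_nonzero proj_line_nonzero, symmetric] by blast
  qed
  then have "Z \<notin> transversal_plane ` ?I"
    by (intro notI, elim imageE) blast
  moreover have "finite (transversal_plane ` ?I)"
    using fin by (simp add: finite_proj_line)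
  ultimately have "card (insert Z (transversal_plane ` ?I)) = Suc (card ?I)"
    by (simp add: card_image[OF inj_on_transversal_plane])
  also have "card ?I = (CARD('a) + 1) * ((CARD('a) + 1) * CARD('a))"
    by (simp only: card_cartesian_product card_proj_line[OF fin])
  finally show ?thesis
    unfolding dim2_in_P32_eq by (simp add: algebra_simps power2_eq_square power3_eq_cube)
qed

section \<open>Classification, counts and adjacency combined\<close>

theorem proposition4p3:
  shows
  \<comment> \<open>(1)\<close>
  "(L.subalgebras_of_dim 3 :: ('a::field ^ 4) set set) =
      {P31 l m | l m. True} \<union> {P32 l m | l m. (l, m) \<noteq> (0, 0)} \<and>
   (\<forall>l m :: 'a. L.heisenberg (P31 l m)) \<and>
   (\<forall>l m :: 'a. (l, m) \<noteq> (0, 0) \<longrightarrow> L.abelian (P32 l m)) \<and>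
   (finite (UNIV :: 'a set) \<longrightarrow>
      card {P31 l m | l m :: 'a. True} = CARD('a) ^ 2 \<and>
      card {P32 l m | l m :: 'a. (l, m) \<noteq> (0, 0)} = CARD('a) + 1 \<and>
      card (L.subalgebras_of_dim 3 :: ('a ^ 4) set set) = CARD('a) ^ 2 + CARD('a) + 1) \<and>
  \<comment> \<open>(2)\<close>
   \<not> (\<exists>M \<in> L.subalgebras_of_dim 2. L.maximal_subalgebra (M :: ('a ^ 4) set)) \<and>
   (\<forall>B \<in> L.subalgebras_of_dim 2. (\<exists>l m :: 'a. B \<subseteq> P31 l m) \<longrightarrow>
      e 3 \<in> B \<and> (\<exists>a b c. (a, b, c) \<noteq> (0, 0, 0) \<and> B = Pe3 a b c)) \<and>
   (\<forall>a b c :: 'a. (a, b, c) \<noteq> (0, 0, 0) \<longrightarrow> Pe3 a b c \<in> L.subalgebras_of_dim 2) \<and>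
   (finite (UNIV :: 'a set) \<longrightarrow>
      card {Pe3 a b c | a b c :: 'a. (a, b, c) \<noteq> (0, 0, 0)} = CARD('a) ^ 2 + CARD('a) + 1) \<and>
   (\<forall>a b c :: 'a. (a, b, c) \<noteq> (0, 0, 0) \<longrightarrow>
      (\<exists>l m. (l, m) \<noteq> (0, 0) \<and> Pe3 a b c \<subseteq> P32 l m)) \<and>
   (\<forall>l m :: 'a. (l, m) \<noteq> (0, 0) \<longrightarrow>
      (\<forall>S. vec.subspace S \<longrightarrow> vec.dim S = 2 \<longrightarrow> S \<subseteq> P32 l m \<longrightarrow> L.subalgebra S)) \<and>
   (finite (UNIV :: 'a set) \<longrightarrow>
      card {B \<in> L.subalgebras_of_dim 2. \<exists>l m :: 'a. (l, m) \<noteq> (0, 0) \<and> B \<subseteq> P32 l m} =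
        CARD('a) ^ 3 + 2 * CARD('a) ^ 2 + CARD('a) + 1) \<and>
  \<comment> \<open>(3)\<close>
   (\<forall>A \<in> L.subalgebras_of_dim 3. \<forall>B \<in> L.subalgebras_of_dim 3.
      (A :: ('a ^ 4) set) \<noteq> B \<longrightarrow> A \<rightarrow>\<^bsub>L.comaximal_graph\<^esub> B) \<and>
   (finite (UNIV :: 'a set) \<longrightarrow>
      K\<^bsub>CARD('a) ^ 2 + CARD('a) + 1\<^esub>
        ((L.comaximal_graph :: (('a ^ 4) set, _) pre_digraph) \<restriction> L.subalgebras_of_dim 3)) \<and>
  \<comment> \<open>(4)\<close>
   (\<forall>A \<in> L.subalgebras_of_dim 2. \<forall>B \<in> L.subalgebras_of_dim 2.
      A \<rightarrow>\<^bsub>L.comaximal_graph\<^esub> B \<longleftrightarrow>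
      \<not> (\<exists>P \<in> L.subalgebras_of_dim 3. (A :: ('a ^ 4) set) \<subseteq> P \<and> B \<subseteq> P)) \<and>
  \<comment> \<open>(5)\<close>
   (\<forall>A \<in> L.subalgebras_of_dim 1. \<forall>B \<in> L.subalgebras_of_dim 2.
      A \<rightarrow>\<^bsub>L.comaximal_graph\<^esub> B \<longleftrightarrow>
      \<not> (\<exists>P \<in> L.subalgebras_of_dim 3. (A :: ('a ^ 4) set) \<subseteq> P \<and> B \<subseteq> P))"
proof (intro conjI)
  show "finite (UNIV :: 'a set) \<longrightarrow>
      card {P31 l m | l m :: 'a. True} = CARD('a) ^ 2 \<and>
      card {P32 l m | l m :: 'a. (l, m) \<noteq> (0, 0)} = CARD('a) + 1 \<and>
      card (L.subalgebras_of_dim 3 :: ('a ^ 4) set set) = CARD('a) ^ 2 + CARD('a) + 1"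
    by (intro impI conjI card_P31 card_P32 card_dim3(2))
  show "\<not> (\<exists>M \<in> L.subalgebras_of_dim 2. L.maximal_subalgebra (M :: ('a ^ 4) set))"
    using dim2_not_maximal by blast
  show "\<forall>B \<in> L.subalgebras_of_dim 2. (\<exists>l m :: 'a. B \<subseteq> P31 l m) \<longrightarrow>
      e 3 \<in> B \<and> (\<exists>a b c. (a, b, c) \<noteq> (0, 0, 0) \<and> B = Pe3 a b c)"
  proof (intro ballI impI)
    fix B assume B: "B \<in> L.subalgebras_of_dim 2" "\<exists>l m :: 'a. B \<subseteq> P31 l m"
    then obtain l m where "B \<subseteq> P31 l m"
      by blast
    with B(1) obtain a b c where abc: "(a, b, c) \<noteq> (0, 0, 0)" "B = Pe3 a b c"
      by (rule dim2_subset_P31)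
    have "e 3 \<in> B"
      unfolding abc(2) by (rule e3_in_P)
    then show "e 3 \<in> B \<and> (\<exists>a b c. (a, b, c) \<noteq> (0, 0, 0) \<and> B = Pe3 a b c)"
      using abc by (intro conjI exI)
  qed
  show "\<forall>a b c :: 'a. (a, b, c) \<noteq> (0, 0, 0) \<longrightarrow> (\<exists>l m. (l, m) \<noteq> (0, 0) \<and> Pe3 a b c \<subseteq> P32 l m)"
  proof (intro allI impI)
    fix a b c :: 'a assume "(a, b, c) \<noteq> (0, 0, 0)"
    then obtain l m where "(l, m) \<noteq> (0, 0)" "Pe3 a b c \<subseteq> P32 l m"
      by (rule Pe3_subset_P32)
    then show "\<exists>l m. (l, m) \<noteq> (0, 0) \<and> Pe3 a b c \<subseteq> P32 l m"
      by (intro exI conjI)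
  qed
  show "\<forall>l m :: 'a. (l, m) \<noteq> (0, 0) \<longrightarrow>
      (\<forall>S. vec.subspace S \<longrightarrow> vec.dim S = 2 \<longrightarrow> S \<subseteq> P32 l m \<longrightarrow> L.subalgebra S)"
    by (intro allI impI subalgebra_subset_P32)
  show "finite (UNIV :: 'a set) \<longrightarrow>
      K\<^bsub>CARD('a) ^ 2 + CARD('a) + 1\<^esub>
        ((L.comaximal_graph :: (('a ^ 4) set, _) pre_digraph) \<restriction> L.subalgebras_of_dim 3)"
  proof
    assume fin: "finite (UNIV :: 'a set)"
    show "K\<^bsub>CARD('a) ^ 2 + CARD('a) + 1\<^esub>
        ((L.comaximal_graph :: (('a ^ 4) set, _) pre_digraph) \<restriction> L.subalgebras_of_dim 3)"
      using complete_graph_dim3[OF card_dim3(1)[OF fin]] unfolding card_dim3(2)[OF fin] .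
  qed
  show "\<forall>A \<in> L.subalgebras_of_dim 2. \<forall>B \<in> L.subalgebras_of_dim 2.
      A \<rightarrow>\<^bsub>L.comaximal_graph\<^esub> B \<longleftrightarrow>
      \<not> (\<exists>P \<in> L.subalgebras_of_dim 3. (A :: ('a ^ 4) set) \<subseteq> P \<and> B \<subseteq> P)"
    by (intro ballI, rule adjacent_iff[where n = 2 and k = 2]) simp_all
  show "\<forall>A \<in> L.subalgebras_of_dim 1. \<forall>B \<in> L.subalgebras_of_dim 2.
      A \<rightarrow>\<^bsub>L.comaximal_graph\<^esub> B \<longleftrightarrow>
      \<not> (\<exists>P \<in> L.subalgebras_of_dim 3. (A :: ('a ^ 4) set) \<subseteq> P \<and> B \<subseteq> P)"
    by (intro ballI, rule adjacent_iff[where n = 1 and k = 2]) simp_all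
  show "\<forall>A \<in> L.subalgebras_of_dim 3. \<forall>B \<in> L.subalgebras_of_dim 3.
      (A :: ('a ^ 4) set) \<noteq> B \<longrightarrow> A \<rightarrow>\<^bsub>L.comaximal_graph\<^esub> B"
    by (intro ballI impI adjacent_dim3)
  show "L.subalgebras_of_dim 3 = {P31 l m | l m :: 'a. True} \<union> {P32 l m | l m. (l, m) \<noteq> (0, 0)}"
    by (rule subalgebras_dim3)
  show "\<forall>l m :: 'a. L.heisenberg (P31 l m)"
    by (intro allI heisenberg_P31)
  show "\<forall>l m :: 'a. (l, m) \<noteq> (0, 0) \<longrightarrow> L.abelian (P32 l m)"
    by (intro allI impI abelian_P32)
  show "\<forall>a b c :: 'a. (a, b, c) \<noteq> (0, 0, 0) \<longrightarrow> Pe3 a b c \<in> L.subalgebras_of_dim 2"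
    by (intro allI impI Pe3_dim2)
  show "finite (UNIV :: 'a set) \<longrightarrow>
      card {Pe3 a b c | a b c :: 'a. (a, b, c) \<noteq> (0, 0, 0)} = CARD('a) ^ 2 + CARD('a) + 1"
    by (rule impI, rule card_Pe3)
  show "finite (UNIV :: 'a set) \<longrightarrow>
      card {B \<in> L.subalgebras_of_dim 2. \<exists>l m :: 'a. (l, m) \<noteq> (0, 0) \<and> B \<subseteq> P32 l m} =
        CARD('a) ^ 3 + 2 * CARD('a) ^ 2 + CARD('a) + 1"
    by (rule impI, rule card_dim2_in_P32)
qed

end
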